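(* Consider the discrete-time linear system $x_{k+1} = A x_k + B u_k$ with $A\in\mathbb{R}^{n\times n}$, $B\in\mathbb{R}^{n\times m}$, a polyhedral safe set $\mathcal{X}_0=\{x\in\mathbb{R}^n \mid Gx\le c\}$, and the learned safety filter policy $\pi_\theta(x_0,\hat u)$ with parameters $\theta=\{H,W_b,b_b\}$ (as defined in the context). Assume that for every $x_0\in\mathcal{X}_0$ and every $\hat u\in\mathbb{R}^m$ the quadratic program defining $\pi_\theta(x_0,\hat u)$ attains an optimal solution. Let $z^\star$ be the optimal value of the nonconvex quadratically constrained quadratic program $$ \begin{aligned} \min_{x_0,\hat u,v,y,\mu}\quad & -\,v^\top\bigl(G(Ax_0+B\,y_{[1:m]})-c\bigr)\\ \text{s.t.}\quad & Gx_0\le c,\\ & v\ge 0,\quad \mathbf{1}^\top v=1,\\ & Py-E_1^\top\hat u-H^\top\mu=0,\\ & Hy+W_bx_0+b_b\ge 0,\\ & \mu\ge 0,\\ & \mu^\top(Hy+W_bx_0+b_b)=0, \end{aligned} $$ where $x_0\in\mathbb{R}^n$, $\hat u\in\mathbb{R}^m$, $y\in\mathbb{R}^{Nm}$, $\mu$ has as many entries as $H$ has rows, and $v$ has as many entries as $G$ has rows. If $z^\star\ge 0$, then the policy $\pi_\theta$ is persistently safe for all initial states $x_0\in\mathcal{X}_0$ and for any given reference control $\hat u$.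
   Context: Notation. $n$ is the state dimension, $m$ the input dimension, $N\ge 1$ an integer (prediction horizon). Vector inequalities are componentwise; $\mathbf{1}$ is the all-ones vector; $y_{[1:m]}$ denotes the first $m$ entries of $y\in\mathbb{R}^{Nm}$. $E_1=[\,I_m\;\;\mathbf{0}\,]\in\mathbb{R}^{m\times Nm}$, so $E_1y=y_{[1:m]}$. $P=\mathrm{diag}(I_m,\varepsilon I_{(N-1)m})\in\mathbb{R}^{Nm\times Nm}$ with a fixed $\varepsilon>0$. The "optimal value" of a minimization problem is the infimum of its objective over its feasible set. Learned safety filter. The parameters are $H\in\mathbb{R}^{q\times Nm}$, $W_b\in\mathbb{R}^{q\times n}$, $b_b\in\mathbb{R}^{q}$ (for some number $q$ of constraints), arbitrary but fixed. Given a current state $x_0\in\mathbb{R}^n$ and a reference control $\hat u\in\mathbb{R}^m$, the policy outputs $\pi_\theta(x_0,\hat u)=y^*_{[1:m]}$, where $y^*$ is the optimal solution of the convex quadratic program $$\min_{y\in\mathbb{R}^{Nm}}\ \tfrac12 y^\top Py-(E_1^\top\hat u)^\top y\quad\text{s.t.}\quad Hy+W_bx_0+b_b\ge 0 .$$ Persistent safety. The policy is persistently safe for all initial states in $\mathcal{X}_0$ and any reference control if, whenever the system starts in a state $x_0\in\mathcal{X}_0$, the filter keeps the next state in the safe set at every step: for every $x_0\in\mathcal{X}_0$ and every sequence of reference controls $\hat u_0,\hat u_1,\dots\in\mathbb{R}^m$, the closed-loop trajectory $x_{k+1}=Ax_k+B\,\pi_\theta(x_k,\hat u_k)$ satisfies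 $x_k\in\mathcal{X}_0$ for all $k\ge 0$. *)

theory Defs
  imports
    "HOL-Library.Extended_Real"
    "Jordan_Normal_Form.Matrix"
begin

text \<open>
  The order on \<^typ>\<open>real vec\<close> is componentwise and entails equality of dimensions.
\<close>

definition polyhedral_set :: "nat \<Rightarrow> real mat \<Rightarrow> real vec \<Rightarrow> real vec set" where
  "polyhedral_set n G c = {x \<in> carrier_vec n. G *\<^sub>v x \<le> c}"

definition E1_mat :: "nat \<Rightarrow> nat \<Rightarrow> real mat" where
  "E1_mat N m = mat m (N * m) (\<lambda>(i, j). if i = j then 1 else 0)"

definition P_mat :: "nat \<Rightarrow> nat \<Rightarrow> real \<Rightarrow> real mat" where
  "P_mat N m \<epsilon> = mat (N * m) (N * m)
     (\<lambda>(i, j). if i = j then (if i < m then 1 else \<epsilon>) else 0)"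

definition filter_feasible ::
  "nat \<Rightarrow> nat \<Rightarrow> real mat \<Rightarrow> real mat \<Rightarrow> real vec \<Rightarrow> real vec \<Rightarrow> real vec set" where
  "filter_feasible N m H Wb bb x0 =
     {y \<in> carrier_vec (N * m). 0\<^sub>v (dim_row H) \<le> H *\<^sub>v y + Wb *\<^sub>v x0 + bb}"

definition filter_objective :: "nat \<Rightarrow> nat \<Rightarrow> real \<Rightarrow> real vec \<Rightarrow> real vec \<Rightarrow> real" where
  "filter_objective N m \<epsilon> u y =
     1 / 2 * (y \<bullet> (P_mat N m \<epsilon> *\<^sub>v y)) - ((E1_mat N m)\<^sup>T *\<^sub>v u) \<bullet> y"

definition filter_optimal ::
  "nat \<Rightarrow> nat \<Rightarrow> real \<Rightarrow> real mat \<Rightarrow> real mat \<Rightarrow> real vec \<Rightarrow> real vec \<Rightarrow> real vec \<Rightarrow> real vec \<Rightarrow> bool"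
where
  "filter_optimal N m \<epsilon> H Wb bb x0 u y \<longleftrightarrow>
     is_arg_min (filter_objective N m \<epsilon> u) (\<lambda>y. y \<in> filter_feasible N m H Wb bb x0) y"

text \<open>
  For \<open>\<epsilon> > 0\<close> the objective is strictly convex, so an optimal solution is unique if it exists;
  the policy is unspecified where the program attains no optimum.
\<close>

definition filter_policy ::
  "nat \<Rightarrow> nat \<Rightarrow> real \<Rightarrow> real mat \<Rightarrow> real mat \<Rightarrow> real vec \<Rightarrow> real vec \<Rightarrow> real vec \<Rightarrow> real vec"
where
  "filter_policy N m \<epsilon> H Wb bb x0 u = vec_first (THE y. filter_optimal N m \<epsilon> H Wb bb x0 u y) m"

primrec closed_loop ::
  "real mat \<Rightarrow> real mat \<Rightarrow> (real vec \<Rightarrow> real vec \<Rightarrow> real vec) \<Rightarrow>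
   real vec \<Rightarrow> (nat \<Rightarrow> real vec) \<Rightarrow> nat \<Rightarrow> real vec"
where
  "closed_loop A B \<pi> x0 u 0 = x0"
| "closed_loop A B \<pi> x0 u (Suc k) =
     A *\<^sub>v closed_loop A B \<pi> x0 u k + B *\<^sub>v \<pi> (closed_loop A B \<pi> x0 u k) (u k)"

definition persistently_safe ::
  "nat \<Rightarrow> real mat \<Rightarrow> real mat \<Rightarrow> (real vec \<Rightarrow> real vec \<Rightarrow> real vec) \<Rightarrow> real vec set \<Rightarrow> bool"
where
  "persistently_safe m A B \<pi> X \<longleftrightarrow>
     (\<forall>x0 \<in> X. \<forall>u. (\<forall>k. u k \<in> carrier_vec m) \<longrightarrow> (\<forall>k. closed_loop A B \<pi> x0 u k \<in> X))"

definition qcqp_feasible ::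
  "nat \<Rightarrow> nat \<Rightarrow> nat \<Rightarrow> real \<Rightarrow> real mat \<Rightarrow> real vec \<Rightarrow> real mat \<Rightarrow> real mat \<Rightarrow> real vec \<Rightarrow>
   (real vec \<times> real vec \<times> real vec \<times> real vec \<times> real vec) set"
where
  "qcqp_feasible n m N \<epsilon> G c H Wb bb =
     {(x0, u, v, y, \<mu>).
        x0 \<in> carrier_vec n \<and> u \<in> carrier_vec m \<and> v \<in> carrier_vec (dim_row G) \<and>
        y \<in> carrier_vec (N * m) \<and> \<mu> \<in> carrier_vec (dim_row H) \<and>
        G *\<^sub>v x0 \<le> c \<and>
        0\<^sub>v (dim_row G) \<le> v \<and> vec (dim_row G) (\<lambda>_. 1) \<bullet> v = 1 \<and>
        P_mat N m \<epsilon> *\<^sub>v y - (E1_mat N m)\<^sup>T *\<^sub>v u - H\<^sup>T *\<^sub>v \<mu> = 0\<^sub>v (N * m) \<and>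
        0\<^sub>v (dim_row H) \<le> H *\<^sub>v y + Wb *\<^sub>v x0 + bb \<and>
        0\<^sub>v (dim_row H) \<le> \<mu> \<and>
        \<mu> \<bullet> (H *\<^sub>v y + Wb *\<^sub>v x0 + bb) = 0}"

text \<open>
  The infimum is taken in the extended reals: it is \<open>\<infinity>\<close> for an infeasible program
  and \<open>-\<infinity>\<close> for an unbounded one.
\<close>

definition qcqp_value ::
  "nat \<Rightarrow> nat \<Rightarrow> nat \<Rightarrow> real \<Rightarrow> real mat \<Rightarrow> real mat \<Rightarrow> real mat \<Rightarrow> real vec \<Rightarrow>
   real mat \<Rightarrow> real mat \<Rightarrow> real vec \<Rightarrow> ereal"
where
  "qcqp_value n m N \<epsilon> A B G c H Wb bb =
     (INF (x0, u, v, y, \<mu>) \<in> qcqp_feasible n m N \<epsilon> G c H Wb bb.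
        ereal (- (v \<bullet> (G *\<^sub>v (A *\<^sub>v x0 + B *\<^sub>v vec_first y m) - c))))"

end

theory Submission
  imports Defs
begin

text \<open>
  At an optimal solution of the filter program the gradient of the objective is nonnegative along
  every direction that does not leave an active constraint, so Farkas' lemma yields KKT multipliers.
  Hence the current state, the reference control, the filter solution, its multipliers and \<open>v\<close> any
  unit vector are feasible for the nonconvex program, and its nonnegative value bounds each component
  of \<open>G x - c\<close> at the next state. Safety for all times follows by induction.
\<close>

section \<open>Farkas' lemma\<close>

text \<open>
  Bartl's induction on the number of functionals: if the hypothesis fails without \<open>a k\<close>, some
  \<open>x\<close> with \<open>a k \<bullet> x = - 1\<close> witnesses this, and one eliminates \<open>a k\<close> by projecting onto its kernel
  along \<open>x\<close>.
\<close>

lemma farkas: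
  fixes a :: "'i \<Rightarrow> real vec"
  assumes "finite I" and "\<And>i. i \<in> I \<Longrightarrow> a i \<in> carrier_vec d" and "c \<in> carrier_vec d"
    and "\<And>x. x \<in> carrier_vec d \<Longrightarrow> (\<And>i. i \<in> I \<Longrightarrow> a i \<bullet> x \<ge> 0) \<Longrightarrow> c \<bullet> x \<ge> 0"
  shows "\<exists>l. (\<forall>i\<in>I. l i \<ge> 0) \<and> (\<forall>x\<in>carrier_vec d. c \<bullet> x = (\<Sum>i\<in>I. l i * (a i \<bullet> x)))"
  using assms
proof (induction I arbitrary: a c rule: finite_induct)
  case empty
  have "c \<bullet> x = 0" if x: "x \<in> carrier_vec d" for x
  proof -
    \<comment> \<open>With no functionals the hypothesis applies to every vector, hence to both x
      and -x.\<close>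
    have "c \<bullet> (- x) \<ge> 0" and "c \<bullet> x \<ge> 0"
      using empty.prems(3) x by auto
    then show ?thesis
      using empty.prems(2) x by simp
  qed
  then show ?case by simp
next
  case (insert k I)
  note a = insert.prems(1) and c = insert.prems(2)
  have ak: "a k \<in> carrier_vec d" using a by simp
  show ?case
  proof (cases "\<forall>x\<in>carrier_vec d. (\<forall>i\<in>I. a i \<bullet> x \<ge> 0) \<longrightarrow> c \<bullet> x \<ge> 0")
    case True
    then obtain l where "\<forall>i\<in>I. l i \<ge> 0"
      and "\<forall>x\<in>carrier_vec d. c \<bullet> x = (\<Sum>i\<in>I. l i * (a i \<bullet> x))"
      using insert.IH[of a c] a c by auto
    moreover have "(\<Sum>i\<in>I. (l(k := 0)) i * (a i \<bullet> x)) = (\<Sum>i\<in>I. l i * (a i \<bullet> x))" for x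
      using insert.hyps by (intro sum.cong) auto
    ultimately show ?thesis
      using insert.hyps by (intro exI[of _ "l(k := 0)"]) auto
  next
    case False
    then obtain x0 where x0: "x0 \<in> carrier_vec d" and nonneg0: "\<And>i. i \<in> I \<Longrightarrow> a i \<bullet> x0 \<ge> 0"
      and neg0: "c \<bullet> x0 < 0"
      by force
    \<comment> \<open>Otherwise \<open>x0\<close> would satisfy the whole premise for
      \<open>insert k I\<close>, against \<open>neg0\<close>.\<close>
    have k0: "a k \<bullet> x0 < 0"
      using insert.prems(3)[of x0] x0 nonneg0 neg0 by force
    \<comment> \<open>Normalized to a k . x1 = -1, so that x + (a k . x) x1 lies in the kernel of
      \<open>a k\<close>.\<close>
    define x1 where "x1 = (1 / - (a k \<bullet> x0)) \<cdot>\<^sub>v x0"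
    have x1: "x1 \<in> carrier_vec d" using x0 by (simp add: x1_def)
    have k1: "a k \<bullet> x1 = - 1" using k0 ak x0 by (simp add: x1_def)
    have nonneg1: "a i \<bullet> x1 \<ge> 0" if "i \<in> I" for i
      using nonneg0[OF that] k0 a[of i] that x0 by (simp add: x1_def divide_nonneg_neg)
    have neg1: "c \<bullet> x1 < 0"
      using neg0 k0 c x0 by (simp add: x1_def divide_neg_neg)
    \<comment> \<open>\<open>pr\<close> is the adjoint of this projection, see \<open>pr'\<close>.
      It sends \<open>a k\<close> to zero, so only the functionals in \<open>I\<close> remain for
      the induction hypothesis.\<close>
    define pr where "pr b = b + (b \<bullet> x1) \<cdot>\<^sub>v a k" for b
    have pr_carrier: "pr b \<in> carrier_vec d" if "b \<in> carrier_vec d" for b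
      using that ak by (simp add: pr_def)
    have pr: "pr b \<bullet> x = b \<bullet> x + (b \<bullet> x1) * (a k \<bullet> x)"
      if "b \<in> carrier_vec d" "x \<in> carrier_vec d" for b x
      using that ak by (simp add: pr_def add_scalar_prod_distrib[of _ d])
    have pr': "b \<bullet> (x + (a k \<bullet> x) \<cdot>\<^sub>v x1) = pr b \<bullet> x"
      if "b \<in> carrier_vec d" "x \<in> carrier_vec d" for b x
      using that x1 by (simp add: pr scalar_prod_add_distrib[of _ d])
    have "\<exists>l. (\<forall>i\<in>I. l i \<ge> 0) \<and>
        (\<forall>x\<in>carrier_vec d. pr c \<bullet> x = (\<Sum>i\<in>I. l i * (pr (a i) \<bullet> x)))"
    proof (rule insert.IH)
      fix x assume x: "x \<in> carrier_vec d" and nn: "\<And>i. i \<in> I \<Longrightarrow> pr (a i) \<bullet> x \<ge> 0"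
      have "a i \<bullet> (x + (a k \<bullet> x) \<cdot>\<^sub>v x1) \<ge> 0" if "i \<in> insert k I" for i
        using that nn[of i] a[of i] x ak k1 by (auto simp: pr' pr)
      then show "pr c \<bullet> x \<ge> 0"
        using insert.prems(3)[of "x + (a k \<bullet> x) \<cdot>\<^sub>v x1"] x x1 c by (simp add: pr')
    qed (use a c pr_carrier in auto)
    then obtain l where l: "\<forall>i\<in>I. l i \<ge> 0"
      and eq: "\<forall>x\<in>carrier_vec d. pr c \<bullet> x = (\<Sum>i\<in>I. l i * (pr (a i) \<bullet> x))"
      by blast
    \<comment> \<open>The coefficient of \<open>a k\<close> once \<open>pr\<close> is expanded in
      \<open>eq\<close> and c . x is isolated. It is nonnegative since c . x1 is negative and each a
      i . x1 with i in \<open>I\<close> is not.\<close>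
    define lk where "lk = (\<Sum>i\<in>I. l i * (a i \<bullet> x1)) - c \<bullet> x1"
    have "lk \<ge> 0"
      using neg1 sum_nonneg[of I "\<lambda>i. l i * (a i \<bullet> x1)"] l nonneg1 by (simp add: lk_def)
    moreover have "c \<bullet> x = lk * (a k \<bullet> x) + (\<Sum>i\<in>I. l i * (a i \<bullet> x))"
      if x: "x \<in> carrier_vec d" for x
    proof -
      have "c \<bullet> x + (c \<bullet> x1) * (a k \<bullet> x) =
          (\<Sum>i\<in>I. l i * (a i \<bullet> x) + l i * (a i \<bullet> x1) * (a k \<bullet> x))"
        using eq x c a by (simp add: pr algebra_simps)
      then show ?thesis
        by (simp add: lk_def sum.distrib left_diff_distrib flip: sum_distrib_right)
    qed
    moreover have "(\<Sum>i\<in>I. (l(k := lk)) i * (a i \<bullet> x)) = (\<Sum>i\<in>I. l i * (a i \<bullet> x))" for x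
      using insert.hyps by (intro sum.cong) auto
    ultimately show ?thesis
      using insert.hyps l by (intro exI[of _ "l(k := lk)"]) auto
  qed
qed

section \<open>Optimality conditions for quadratic programs\<close>

text \<open>Abstract data replace P and the linear term: the optimality conditions rest on symmetry
  of \<open>Q\<close>, and uniqueness also on definiteness.\<close>

definition quad_objective :: "real mat \<Rightarrow> real vec \<Rightarrow> real vec \<Rightarrow> real" where
  "quad_objective Q e y = 1 / 2 * (y \<bullet> (Q *\<^sub>v y)) - e \<bullet> y"

text \<open>The second-order Taylor expansion is exact for a quadratic; symmetry of \<open>Q\<close>
  merges the two cross terms. It drives both uniqueness and the descent argument.\<close>

lemma quad_objective_expand:
  assumes Q: "Q \<in> carrier_mat d d" "Q\<^sup>T = Q" and e: "e \<in> carrier_vec d"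
    and y: "y \<in> carrier_vec d" and z: "z \<in> carrier_vec d"
  shows "quad_objective Q e (y + t \<cdot>\<^sub>v z) =
    quad_objective Q e y + t * ((Q *\<^sub>v y - e) \<bullet> z) + t\<^sup>2 / 2 * (z \<bullet> (Q *\<^sub>v z))"
proof -
  have Qy: "Q *\<^sub>v y \<in> carrier_vec d" and Qz: "Q *\<^sub>v z \<in> carrier_vec d"
    using Q y z by auto
  have sym: "y \<bullet> (Q *\<^sub>v z) = (Q *\<^sub>v y) \<bullet> z"
    using transpose_vec_mult_scalar[OF Q(1) z y] Q(2) by simp
  have comm: "z \<bullet> (Q *\<^sub>v y) = (Q *\<^sub>v y) \<bullet> z"
    using comm_scalar_prod[OF z Qy] .
  have "Q *\<^sub>v (y + t \<cdot>\<^sub>v z) = Q *\<^sub>v y + t \<cdot>\<^sub>v (Q *\<^sub>v z)"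
    using Q(1) y z by (simp add: mult_add_distrib_mat_vec[of _ d d] mult_mat_vec[of _ d d])
  then show ?thesis
    using Qy Qz y z e
    by (simp add: quad_objective_def add_scalar_prod_distrib[of _ d] scalar_prod_add_distrib[of _ d]
        minus_scalar_prod_distrib[of _ d] sym comm power2_eq_square algebra_simps)
qed

lemma vec_le_index:
  fixes v w :: "real vec"
  assumes "v \<in> carrier_vec d" "w \<in> carrier_vec d"
  shows "v \<le> w \<longleftrightarrow> (\<forall>i<d. v $ i \<le> w $ i)"
  using assms by (auto simp: less_eq_vec_def)

text \<open>For a fixed state, \<open>w\<close> stands for the constant
  \<open>Wb *\<^sub>v x + bb\<close>.\<close>

definition lin_feasible :: "nat \<Rightarrow> real mat \<Rightarrow> real vec \<Rightarrow> real vec set" where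
  "lin_feasible d H w = {y \<in> carrier_vec d. 0\<^sub>v (dim_row H) \<le> H *\<^sub>v y + w}"

lemma lin_feasible_iff:
  assumes "H \<in> carrier_mat q d" "w \<in> carrier_vec q" "y \<in> carrier_vec d"
  shows "y \<in> lin_feasible d H w \<longleftrightarrow> (\<forall>i<q. 0 \<le> row H i \<bullet> y + w $ i)"
  using assms by (auto simp: lin_feasible_def vec_le_index[of _ q])

text \<open>Strict convexity: the midpoint of two minimizers is feasible and would have a smaller
  value if they differed. The hypothesis \<open>pos\<close> is positive definiteness in
  contrapositive form.\<close>

lemma is_arg_min_quad_unique:
  assumes Q: "Q \<in> carrier_mat d d" "Q\<^sup>T = Q" and e: "e \<in> carrier_vec d"
    and pos: "\<And>z. z \<in> carrier_vec d \<Longrightarrow> z \<bullet> (Q *\<^sub>v z) \<le> 0 \<Longrightarrow> z = 0\<^sub>v d"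
    and H: "H \<in> carrier_mat q d" and w: "w \<in> carrier_vec q"
    and y: "is_arg_min (quad_objective Q e) (\<lambda>y. y \<in> lin_feasible d H w) y"
    and y': "is_arg_min (quad_objective Q e) (\<lambda>y. y \<in> lin_feasible d H w) y'"
  shows "y = y'"
proof -
  have yf: "y \<in> lin_feasible d H w" and yf': "y' \<in> lin_feasible d H w"
    using y y' by (auto simp: is_arg_min_def)
  then have yc: "y \<in> carrier_vec d" and yc': "y' \<in> carrier_vec d"
    by (auto simp: lin_feasible_def)
  define z where "z = y' - y"
  have z: "z \<in> carrier_vec d" using yc yc' by (simp add: z_def)
  \<comment> \<open>The factor 1 makes \<open>y'\<close> the point t = 1 of the line in the
    expansion.\<close>
  have y'_eq: "y' = y + 1 \<cdot>\<^sub>v z" using yc yc' by (auto simp: z_def)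
  have "y + (1/2) \<cdot>\<^sub>v z \<in> lin_feasible d H w"
  proof -
    have "0 \<le> row H i \<bullet> (y + (1/2) \<cdot>\<^sub>v z) + w $ i" if i: "i < q" for i
    proof -
      have r: "row H i \<in> carrier_vec d" using H i by auto
      have "0 \<le> row H i \<bullet> y + w $ i" "0 \<le> row H i \<bullet> y' + w $ i"
        using yf yf' i yc yc' by (auto simp: lin_feasible_iff[OF H w])
      then show ?thesis
        using r yc yc' z
        by (simp add: scalar_prod_add_distrib[of _ d] z_def scalar_prod_minus_distrib[of _ d] field_simps)
    qed
    then show ?thesis using yc z by (simp add: lin_feasible_iff[OF H w])
  qed
  then have half: "quad_objective Q e y \<le> quad_objective Q e (y + (1/2) \<cdot>\<^sub>v z)"
    using y by (auto simp: is_arg_min_linorder)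
  have full: "quad_objective Q e (y + 1 \<cdot>\<^sub>v z) = quad_objective Q e y"
    using y y' yf yf' y'_eq by (metis is_arg_min_linorder order_antisym)
  \<comment> \<open>Let l be the slope at \<open>y\<close> along \<open>z\<close> and h the
    quadratic form at \<open>z\<close>. Then \<open>full\<close> gives l + h/2 = 0 and
    \<open>half\<close> gives l/2 + h/8 >= 0, hence h <= 0.\<close>
  have "z \<bullet> (Q *\<^sub>v z) \<le> 0"
    using half full unfolding quad_objective_expand[OF Q e yc z]
    by (simp add: power2_eq_square)
  then have "z = 0\<^sub>v d" using pos z by blast
  then show ?thesis using y'_eq yc by simp
qed

text \<open>A short step along \<open>z\<close> stays feasible: active constraints do not decrease
  and inactive ones have slack. A negative slope would then lower the objective, as the quadratic
  term is of second order in the step length.\<close>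

lemma quad_first_order:
  assumes Q: "Q \<in> carrier_mat d d" "Q\<^sup>T = Q" and e: "e \<in> carrier_vec d"
    and H: "H \<in> carrier_mat q d" and w: "w \<in> carrier_vec q"
    and y: "is_arg_min (quad_objective Q e) (\<lambda>y. y \<in> lin_feasible d H w) y"
    and z: "z \<in> carrier_vec d"
    and act: "\<And>i. i < q \<Longrightarrow> row H i \<bullet> y + w $ i = 0 \<Longrightarrow> row H i \<bullet> z \<ge> 0"
  shows "(Q *\<^sub>v y - e) \<bullet> z \<ge> 0"
proof (rule ccontr)
  define s where "s i = row H i \<bullet> y + w $ i" for i
  define g where "g = (Q *\<^sub>v y - e) \<bullet> z"
  define h where "h = z \<bullet> (Q *\<^sub>v z)"
  assume "\<not> (Q *\<^sub>v y - e) \<bullet> z \<ge> 0"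
  then have g: "g < 0" by (simp add: g_def)
  have yf: "y \<in> lin_feasible d H w" using y by (simp add: is_arg_min_def)
  then have yc: "y \<in> carrier_vec d" by (simp add: lin_feasible_def)
  have s_nonneg: "s i \<ge> 0" if "i < q" for i
    using yf that by (simp add: lin_feasible_iff[OF H w yc] s_def)
  have "\<forall>\<^sub>F t in at_right 0. 0 \<le> s i + t * (row H i \<bullet> z)" if i: "i < q" for i
  proof (cases "s i = 0")
    case True
    then have "row H i \<bullet> z \<ge> 0" using act i by (simp add: s_def)
    then show ?thesis
      using True by (auto intro!: eventually_mono[OF eventually_at_right_less[of 0]])
  next
    case False
    have "((\<lambda>t. s i + t * (row H i \<bullet> z)) \<longlongrightarrow> s i + 0 * (row H i \<bullet> z)) (at_right 0)"
      by (intro tendsto_intros)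
    then have "\<forall>\<^sub>F t in at_right 0. 0 < s i + t * (row H i \<bullet> z)"
      by (rule order_tendstoD) (use False s_nonneg[OF i] in simp)
    then show ?thesis by (rule eventually_mono) simp
  qed
  \<comment> \<open>Finitely many constraints share a common range of admissible steps.\<close>
  then have "\<forall>\<^sub>F t in at_right 0. \<forall>i\<in>{..<q}. 0 \<le> s i + t * (row H i \<bullet> z)"
    by (intro eventually_ball_finite) auto
  \<comment> \<open>This is the change of the objective divided by t; it tends to
    \<open>g\<close>.\<close>
  moreover have "\<forall>\<^sub>F t in at_right 0. g + t / 2 * h < 0"
  proof -
    have "((\<lambda>t. g + t / 2 * h) \<longlongrightarrow> g + 0 / 2 * h) (at_right 0)"
      by (intro tendsto_intros) auto
    then show ?thesis by (rule order_tendstoD) (use g in simp)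
  qed
  ultimately have "\<forall>\<^sub>F t::real in at_right 0.
      (\<forall>i\<in>{..<q}. 0 \<le> s i + t * (row H i \<bullet> z)) \<and> g + t / 2 * h < 0 \<and> 0 < t"
    using eventually_at_right_less[of "0::real"] by (intro eventually_conj)
  then obtain t :: real where t: "\<And>i. i < q \<Longrightarrow> 0 \<le> s i + t * (row H i \<bullet> z)"
    and descent: "g + t / 2 * h < 0" and "0 < t"
    using eventually_happens'[OF trivial_limit_at_right_real] by blast
  have "y + t \<cdot>\<^sub>v z \<in> lin_feasible d H w"
  proof -
    have "0 \<le> row H i \<bullet> (y + t \<cdot>\<^sub>v z) + w $ i" if i: "i < q" for i
    proof -
      have "row H i \<in> carrier_vec d" using H i by auto
      then show ?thesis
        using t[OF i] yc z by (simp add: scalar_prod_add_distrib[of _ d] s_def algebra_simps)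
    qed
    then show ?thesis using yc z by (simp add: lin_feasible_iff[OF H w])
  qed
  then have "quad_objective Q e y \<le> quad_objective Q e (y + t \<cdot>\<^sub>v z)"
    using y by (auto simp: is_arg_min_linorder)
  then have "0 \<le> t * (g + t / 2 * h)"
    unfolding quad_objective_expand[OF Q e yc z]
    by (simp add: g_def h_def power2_eq_square algebra_simps)
  then show False
    using descent \<open>0 < t\<close> by (simp add: zero_le_mult_iff)
qed

text \<open>Farkas' lemma for the rows of the active constraints: \<open>quad_first_order\<close> is
  its hypothesis for the gradient, and the coefficients it yields are the multipliers.\<close>

lemma quad_kkt:
  assumes Q: "Q \<in> carrier_mat d d" "Q\<^sup>T = Q" and e: "e \<in> carrier_vec d"
    and H: "H \<in> carrier_mat q d" and w: "w \<in> carrier_vec q"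
    and y: "is_arg_min (quad_objective Q e) (\<lambda>y. y \<in> lin_feasible d H w) y"
  obtains \<mu> where "\<mu> \<in> carrier_vec q" "0\<^sub>v q \<le> \<mu>"
    "Q *\<^sub>v y - e - H\<^sup>T *\<^sub>v \<mu> = 0\<^sub>v d" "\<mu> \<bullet> (H *\<^sub>v y + w) = 0"
proof -
  define I where "I = {i. i < q \<and> row H i \<bullet> y + w $ i = 0}"
  have yc: "y \<in> carrier_vec d"
    using y by (simp add: is_arg_min_def lin_feasible_def)
  have g: "Q *\<^sub>v y - e \<in> carrier_vec d" using Q e yc by (intro minus_carrier_vec mult_mat_vec_carrier)
  have "\<exists>l. (\<forall>i\<in>I. l i \<ge> 0) \<and>
      (\<forall>x\<in>carrier_vec d. (Q *\<^sub>v y - e) \<bullet> x = (\<Sum>i\<in>I. l i * (row H i \<bullet> x)))"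
    by (rule farkas) (use H g in \<open>auto simp: I_def intro!: quad_first_order[OF Q e H w y]\<close>)
  then obtain l where l: "\<forall>i\<in>I. l i \<ge> 0"
    and eq: "\<And>x. x \<in> carrier_vec d \<Longrightarrow> (Q *\<^sub>v y - e) \<bullet> x = (\<Sum>i\<in>I. l i * (row H i \<bullet> x))"
    by blast
  \<comment> \<open>Zero off the active set, so in each product either the multiplier or the slack
    vanishes: complementary slackness.\<close>
  define \<mu> where "\<mu> = vec q (\<lambda>i. if i \<in> I then l i else 0)"
  have \<mu>: "\<mu> \<in> carrier_vec q" by (simp add: \<mu>_def)
  have "(Q *\<^sub>v y - e) $ j = (H\<^sup>T *\<^sub>v \<mu>) $ j" if j: "j < d" for j
  proof -
    \<comment> \<open>Testing the identity of functionals on unit vectors gives stationarity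
      coordinate by coordinate.\<close>
    have "(Q *\<^sub>v y - e) $ j = (Q *\<^sub>v y - e) \<bullet> unit_vec d j"
      using g j by simp
    also have "\<dots> = (\<Sum>i\<in>I. l i * (row H i \<bullet> unit_vec d j))"
      by (simp add: eq)
    also have "\<dots> = (\<Sum>i\<in>I. l i * H $$ (i, j))"
      using H j by (intro sum.cong) (auto simp: I_def)
    also have "\<dots> = (\<Sum>i\<in>{0..<q}. if i \<in> I then l i * H $$ (i, j) else 0)"
      by (rule sum.mono_neutral_cong_left) (auto simp: I_def)
    also have "\<dots> = (H\<^sup>T *\<^sub>v \<mu>) $ j"
      using H j by (auto simp: scalar_prod_def \<mu>_def intro!: sum.cong)
    finally show ?thesis .
  qed
  then have "Q *\<^sub>v y - e - H\<^sup>T *\<^sub>v \<mu> = 0\<^sub>v d"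
    using H g Q e by (intro eq_vecI) auto
  moreover have "\<mu> \<bullet> (H *\<^sub>v y + w) = 0"
    using H w by (auto simp: scalar_prod_def \<mu>_def I_def intro!: sum.neutral)
  moreover have "0\<^sub>v q \<le> \<mu>"
    using l by (auto simp: vec_le_index[of _ q] \<mu>_def)
  ultimately show thesis using that \<mu> by blast
qed

section \<open>The safety filter\<close>

lemma P_mat_carrier [simp]: "P_mat N m \<epsilon> \<in> carrier_mat (N * m) (N * m)"
  by (simp add: P_mat_def)

lemma E1_mat_carrier [simp]: "E1_mat N m \<in> carrier_mat m (N * m)"
  by (simp add: E1_mat_def)

lemma transpose_P_mat: "(P_mat N m \<epsilon>)\<^sup>T = P_mat N m \<epsilon>"
  by (rule eq_matI) (auto simp: P_mat_def)

text \<open>The form is a sum of squares with positive weights, the diagonal entries 1 and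
  \<epsilon>.\<close>

lemma P_mat_pos_def:
  assumes "\<epsilon> > 0" "z \<in> carrier_vec (N * m)" "z \<bullet> (P_mat N m \<epsilon> *\<^sub>v z) \<le> 0"
  shows "z = 0\<^sub>v (N * m)"
proof -
  define a where "a i = (if i < m then 1 else \<epsilon>)" for i
  have "(P_mat N m \<epsilon> *\<^sub>v z) $ i = a i * z $ i" if i: "i < N * m" for i
  proof -
    have "(P_mat N m \<epsilon> *\<^sub>v z) $ i = (\<Sum>j\<in>{0..<N * m}. (if i = j then a i else 0) * z $ j)"
      using assms(2) i by (auto simp: P_mat_def scalar_prod_def a_def intro!: sum.cong)
    also have "\<dots> = (\<Sum>j\<in>{0..<N * m}. if i = j then a i * z $ i else 0)"
      by (intro sum.cong) auto
    finally show ?thesis using i by simp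
  qed
  then have "z \<bullet> (P_mat N m \<epsilon> *\<^sub>v z) = (\<Sum>i\<in>{0..<N * m}. a i * (z $ i)\<^sup>2)"
    by (simp add: scalar_prod_def P_mat_def power2_eq_square algebra_simps)
  moreover have nonneg: "a i * (z $ i)\<^sup>2 \<ge> 0" for i
    using assms(1) by (simp add: a_def)
  ultimately have "(\<Sum>i\<in>{0..<N * m}. a i * (z $ i)\<^sup>2) = 0"
    using assms(3) sum_nonneg[of "{0..<N * m}" "\<lambda>i. a i * (z $ i)\<^sup>2"] by simp
  then have "a i * (z $ i)\<^sup>2 = 0" if "i < N * m" for i
    using that nonneg by (simp add: sum_nonneg_eq_0_iff)
  moreover have "a i \<noteq> 0" for i using assms(1) by (simp add: a_def)
  ultimately show ?thesis
    using assms(2) by (intro eq_vecI) auto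
qed

text \<open>Transfers the general results to the filter. The dimensions allow the constraint to be
  regrouped by associativity of vector addition.\<close>

lemma filter_optimal_iff_quad:
  assumes "H \<in> carrier_mat q (N * m)" "Wb \<in> carrier_mat q n" "bb \<in> carrier_vec q"
    "x \<in> carrier_vec n"
  shows "filter_optimal N m \<epsilon> H Wb bb x u y \<longleftrightarrow>
    is_arg_min (quad_objective (P_mat N m \<epsilon>) ((E1_mat N m)\<^sup>T *\<^sub>v u))
      (\<lambda>y. y \<in> lin_feasible (N * m) H (Wb *\<^sub>v x + bb)) y"
proof -
  have "H *\<^sub>v y + Wb *\<^sub>v x + bb = H *\<^sub>v y + (Wb *\<^sub>v x + bb)" if "y \<in> carrier_vec (N * m)" for y
    using assms that by (intro assoc_add_vec[of _ q]) auto
  then have "filter_feasible N m H Wb bb x = lin_feasible (N * m) H (Wb *\<^sub>v x + bb)"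
    by (auto simp: filter_feasible_def lin_feasible_def)
  moreover have "filter_objective N m \<epsilon> u =
      quad_objective (P_mat N m \<epsilon>) ((E1_mat N m)\<^sup>T *\<^sub>v u)"
    by (simp add: fun_eq_iff filter_objective_def quad_objective_def)
  ultimately show ?thesis by (simp add: filter_optimal_def)
qed

text \<open>Uniqueness makes the definite description in the policy denote the given
  optimum.\<close>

lemma filter_policy_eq:
  assumes "\<epsilon> > 0"
    and "H \<in> carrier_mat q (N * m)" "Wb \<in> carrier_mat q n" "bb \<in> carrier_vec q"
    and "x \<in> carrier_vec n" "u \<in> carrier_vec m"
    and y: "filter_optimal N m \<epsilon> H Wb bb x u y"
  shows "filter_policy N m \<epsilon> H Wb bb x u = vec_first y m"
proof -
  have "y' = y" if "filter_optimal N m \<epsilon> H Wb bb x u y'" for y'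
    by (rule is_arg_min_quad_unique[OF P_mat_carrier transpose_P_mat])
      (use assms that in \<open>auto simp: filter_optimal_iff_quad
          intro: P_mat_pos_def mult_mat_vec_carrier[of _ _ m]\<close>)
  then have "(THE y. filter_optimal N m \<epsilon> H Wb bb x u y) = y"
    using y by blast
  then show ?thesis by (simp add: filter_policy_def)
qed

text \<open>The multipliers come from \<open>quad_kkt\<close>. Taking v to be a vertex of the
  simplex turns the objective of the nonconvex program into minus a single component of G x - c at
  the next state.\<close>

lemma filter_optimal_qcqp_feasible:
  assumes H: "H \<in> carrier_mat q (N * m)" and Wb: "Wb \<in> carrier_mat q n"
    and bb: "bb \<in> carrier_vec q" and G: "G \<in> carrier_mat p n"
    and x: "x \<in> polyhedral_set n G c" and u: "u \<in> carrier_vec m"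
    and y: "filter_optimal N m \<epsilon> H Wb bb x u y" and i: "i < p"
  obtains \<mu> where "(x, u, unit_vec p i, y, \<mu>) \<in> qcqp_feasible n m N \<epsilon> G c H Wb bb"
proof -
  have xc: "x \<in> carrier_vec n" and Gx: "G *\<^sub>v x \<le> c"
    using x by (auto simp: polyhedral_set_def)
  have yc: "y \<in> carrier_vec (N * m)" and yf: "0\<^sub>v q \<le> H *\<^sub>v y + Wb *\<^sub>v x + bb"
    using y H by (auto simp: filter_optimal_def is_arg_min_def filter_feasible_def)
  have w: "Wb *\<^sub>v x + bb \<in> carrier_vec q" and e: "(E1_mat N m)\<^sup>T *\<^sub>v u \<in> carrier_vec (N * m)"
    using Wb bb xc u by (auto intro: mult_mat_vec_carrier[of _ _ m])
  have assoc: "H *\<^sub>v y + Wb *\<^sub>v x + bb = H *\<^sub>v y + (Wb *\<^sub>v x + bb)"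
    using H Wb bb xc yc by (intro assoc_add_vec[of _ q]) auto
  obtain \<mu> where "\<mu> \<in> carrier_vec q" "0\<^sub>v q \<le> \<mu>"
    "P_mat N m \<epsilon> *\<^sub>v y - (E1_mat N m)\<^sup>T *\<^sub>v u - H\<^sup>T *\<^sub>v \<mu> = 0\<^sub>v (N * m)"
    "\<mu> \<bullet> (H *\<^sub>v y + (Wb *\<^sub>v x + bb)) = 0"
    using quad_kkt[OF P_mat_carrier transpose_P_mat e H w] y
    unfolding filter_optimal_iff_quad[OF H Wb bb xc] by blast
  moreover have "vec p (\<lambda>_. 1) \<bullet> unit_vec p i = (1 :: real)" using i by simp
  moreover have "0\<^sub>v p \<le> (unit_vec p i :: real vec)"
    by (auto simp: less_eq_vec_def unit_vec_def)
  ultimately have "(x, u, unit_vec p i, y, \<mu>) \<in> qcqp_feasible n m N \<epsilon> G c H Wb bb"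
    using H G xc Gx yc yf u by (simp add: qcqp_feasible_def assoc)
  then show thesis by (rule that)
qed

lemma filter_policy_invariant:
  assumes "\<epsilon> > 0"
    and A: "A \<in> carrier_mat n n" and B: "B \<in> carrier_mat n m"
    and G: "G \<in> carrier_mat p n" and c: "c \<in> carrier_vec p"
    and H: "H \<in> carrier_mat q (N * m)" and Wb: "Wb \<in> carrier_mat q n"
    and bb: "bb \<in> carrier_vec q"
    and x: "x \<in> polyhedral_set n G c" and u: "u \<in> carrier_vec m"
    and y: "filter_optimal N m \<epsilon> H Wb bb x u y"
    and value_nonneg: "qcqp_value n m N \<epsilon> A B G c H Wb bb \<ge> 0"
  shows "A *\<^sub>v x + B *\<^sub>v filter_policy N m \<epsilon> H Wb bb x u \<in> polyhedral_set n G c"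
proof -
  have xc: "x \<in> carrier_vec n" using x by (simp add: polyhedral_set_def)
  define x' where "x' = A *\<^sub>v x + B *\<^sub>v vec_first y m"
  have x': "x' \<in> carrier_vec n"
    using A B xc by (auto simp: x'_def intro: mult_mat_vec_carrier[of _ _ m])
  \<comment> \<open>For p = 0 there is no component to check; the simplex is then empty and the
    value of the program is infinite.\<close>
  have "(G *\<^sub>v x') $ i \<le> c $ i" if i: "i < p" for i
  proof -
    obtain \<mu> where "(x, u, unit_vec p i, y, \<mu>) \<in> qcqp_feasible n m N \<epsilon> G c H Wb bb"
      using filter_optimal_qcqp_feasible[OF H Wb bb G x u y i] .
    \<comment> \<open>The infimum is at most the objective at this feasible point.\<close>
    then have "qcqp_value n m N \<epsilon> A B G c H Wb bb \<le>
        ereal (- (unit_vec p i \<bullet> (G *\<^sub>v x' - c)))"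
      unfolding qcqp_value_def x'_def by (rule INF_lower2) simp
    then have "0 \<le> - (unit_vec p i \<bullet> (G *\<^sub>v x' - c))"
      using value_nonneg by (metis order_trans ereal_less_eq(5))
    moreover have "G *\<^sub>v x' - c \<in> carrier_vec p" using G c x' by (intro minus_carrier_vec mult_mat_vec_carrier)
    ultimately show ?thesis
      using G c i by simp
  qed
  then have "x' \<in> polyhedral_set n G c"
    using G c x' by (auto simp: polyhedral_set_def vec_le_index[of _ p])
  then show ?thesis
    using filter_policy_eq[OF \<open>\<epsilon> > 0\<close> H Wb bb xc u y] by (simp add: x'_def)
qed

theorem theorem1:
  fixes n m N p q :: nat
    and \<epsilon> :: real
    and A B G H Wb :: "real mat"
    and c bb :: "real vec"
  assumes "N \<ge> 1" and "\<epsilon> > 0"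
    and "A \<in> carrier_mat n n" and "B \<in> carrier_mat n m"
    and "G \<in> carrier_mat p n" and "c \<in> carrier_vec p"
    and "H \<in> carrier_mat q (N * m)" and "Wb \<in> carrier_mat q n" and "bb \<in> carrier_vec q"
    and "\<And>x0 u. x0 \<in> polyhedral_set n G c \<Longrightarrow> u \<in> carrier_vec m \<Longrightarrow>
           \<exists>y. filter_optimal N m \<epsilon> H Wb bb x0 u y"
    and "qcqp_value n m N \<epsilon> A B G c H Wb bb \<ge> 0"
  shows "persistently_safe m A B (filter_policy N m \<epsilon> H Wb bb) (polyhedral_set n G c)"
  unfolding persistently_safe_def
proof (intro ballI allI impI)
  fix x0 and u :: "nat \<Rightarrow> real vec" and k
  assume x0: "x0 \<in> polyhedral_set n G c" and u: "\<forall>k. u k \<in> carrier_vec m"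
  show "closed_loop A B (filter_policy N m \<epsilon> H Wb bb) x0 u k \<in> polyhedral_set n G c"
  proof (induction k)
    case 0
    then show ?case using x0 by simp
  next
    case (Suc k)
    moreover have uk: "u k \<in> carrier_vec m" using u by simp
    \<comment> \<open>The induction hypothesis makes attainment available here: an optimum is
      assumed only at safe states.\<close>
    ultimately obtain y where
      "filter_optimal N m \<epsilon> H Wb bb (closed_loop A B (filter_policy N m \<epsilon> H Wb bb) x0 u k) (u k) y"
      using assms(10) by blast
    then show ?case
      using filter_policy_invariant[OF assms(2-9) Suc uk _ assms(11)] by simp
  qed
qed

end
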